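(* The following relations hold in $\mathbb{V}$. For all $i\in\mathbb{N}$, $$q(xC^{s}_{i+1})\star(xC^{s}_i)=-q^{-1}(xC^{s}_i)\star(xC^{s}_{i+1}),\qquad q(C^{s}_iy)\star(C^{s}_{i+1}y)=-q^{-1}(C^{s}_{i+1}y)\star(C^{s}_iy).$$ For all distinct $i,j\in\mathbb{N}$, $$q(xC^{s}_{i+1})\star(xC^{s}_j)+q^{-1}(xC^{s}_j)\star(xC^{s}_{i+1})=-q^{-1}(xC^{s}_i)\star(xC^{s}_{j+1})-q(xC^{s}_{j+1})\star(xC^{s}_i),$$ $$q(C^{s}_jy)\star(C^{s}_{i+1}y)+q^{-1}(C^{s}_{i+1}y)\star(C^{s}_jy)=-q^{-1}(C^{s}_{j+1}y)\star(C^{s}_iy)-q(C^{s}_iy)\star(C^{s}_{j+1}y).$$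
   Context: Ground field $\mathbb{F}=\mathbb{Q}(q)$, $q$ an indeterminate; $\mathbb{N}=\{0,1,2,\ldots\}$; $\{n\}_q=\frac{q^{-n}-(-1)^nq^n}{q+q^{-1}}$. $\mathbb{V}$ is the free associative unital $\mathbb{F}$-algebra on noncommuting $x,y$; words form a basis; the empty word is $1$; juxtaposition denotes concatenation. The $q$-shuffle superproduct $\star$ is the bilinear associative product on $\mathbb{V}$ with $1\star v=v\star1=v$ and, for nontrivial words $u=u_1\cdots u_r$, $v=v_1\cdots v_s$, recursively $$u\star v=u_1\big((u_2\cdots u_r)\star v\big)+(-1)^r v_1\big(u\star(v_2\cdots v_s)\big)q^{\langle u_1,v_1\rangle+\cdots+\langle u_r,v_1\rangle},$$ where $\langle x,x\rangle=\langle y,y\rangle=2$, $\langle x,y\rangle=\langle y,x\rangle=-2$. Catalan elements: put $\bar x=1$, $\bar y=-1$. A word $a_1\cdots a_m$ is Catalan if $\bar a_1+\cdots+\bar a_m=0$ and $\bar a_1+\cdots+\bar a_i\ge0$ for all $1\le i\le m$. $\mathrm{Cat}_n$ is the set of Catalan words of length $2n$. Define $C^s(1)=1$, and for $n\ge1$, $w\in\mathrm{Cat}_n$, $$C^{s}(w)=\sum_{v\in\mathrm{Cat}_{n-1}}C^{s}(v)\sum_i(-1)^i\{2+2\bar a_1+\cdots+2\bar a_i\}_q,$$ where, for $v=a_1\cdots a_m$ ($m=2n-2$), the inner sum is over the $i$, $0\le i\le m$, such that $w=a_1\cdots a_i\,x\,a_{i+1}\cdots a_m\,y$. Set $C^{s}_n=\sum_{w\in\mathrm{Cat}_n}C^s(w)\,w\in\mathbb{V}$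 (so $C^s_0=1$, $C^s_1=\{2\}_qxy$). $xC^s_n$, $C^s_ny$ are concatenation products. *)

theory Defs
  imports
    "HOL-Library.Poly_Mapping"
    "HOL-Computational_Algebra.Polynomial"
    "HOL-Computational_Algebra.Fraction_Field"
begin

type_synonym scalar = "rat poly fract"

definition qvar :: scalar (\<open>\<q>\<close>) where
  "\<q> = Fract [:0, 1:] 1"

definition qbracket :: "int \<Rightarrow> scalar" (\<open>{_}\<^sub>q\<close>) where
  "{n}\<^sub>q = (\<q> powi (- n) - (- 1) powi n * \<q> powi n) / (\<q> + inverse \<q>)"

lemma qvar_nonzero: "\<q> \<noteq> 0"
  by (simp add: qvar_def Zero_fract_def eq_fract)

lemma qbracket_denominator_nonzero: "\<q> + inverse \<q> \<noteq> 0"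
proof -
  have "\<q> + inverse \<q> = Fract [:1, 0, 1:] [:0, 1:]"
    by (simp add: qvar_def one_pCons)
  also have "\<dots> \<noteq> 0"
    by (simp add: Zero_fract_def eq_fract)
  finally show ?thesis .
qed

datatype letter = X | Y

type_synonym word = "letter list"

(* With concatenation as the monoid operation on words, the convolution product
   that Poly_Mapping puts on finitely supported functions is the product of the
   free algebra. *)

instantiation list :: (type) monoid_add
begin

definition zero_list :: "'a list" where "0 = []"

definition plus_list :: "'a list \<Rightarrow> 'a list \<Rightarrow> 'a list" where "u + v = u @ v"

instance by standard (simp_all add: zero_list_def plus_list_def)

end

type_synonym free_alg = "word \<Rightarrow>\<^sub>0 scalar"

abbreviation of_word :: "word \<Rightarrow> free_alg" where
  "of_word w \<equiv> Poly_Mapping.single w 1"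

abbreviation x_elem :: free_alg (\<open>\<x>\<close>) where
  "\<x> \<equiv> of_word [X]"

abbreviation y_elem :: free_alg (\<open>\<y>\<close>) where
  "\<y> \<equiv> of_word [Y]"

definition scale :: "scalar \<Rightarrow> free_alg \<Rightarrow> free_alg" (infixr \<open>\<cdot>\<close> 75) where
  "c \<cdot> p = Poly_Mapping.map ((*) c) p"

lemma lookup_scale: "Poly_Mapping.lookup (c \<cdot> p) w = c * Poly_Mapping.lookup p w"
  by (simp add: scale_def Poly_Mapping.map.rep_eq when_def)

lemma of_word_Nil: "of_word [] = 1"
  by (simp flip: zero_list_def single_one)

lemma of_word_mult: "of_word u * of_word v = of_word (u @ v)"
  by (simp add: Poly_Mapping.mult_single plus_list_def)

fun pairing :: "letter \<Rightarrow> letter \<Rightarrow> int" (\<open>\<langle>_, _\<rangle>\<close>) where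
  "\<langle>X, X\<rangle> = 2"
| "\<langle>Y, Y\<rangle> = 2"
| "\<langle>X, Y\<rangle> = - 2"
| "\<langle>Y, X\<rangle> = - 2"

fun shuffle_word :: "word \<Rightarrow> word \<Rightarrow> free_alg" where
  "shuffle_word [] v = of_word v"
| "shuffle_word u [] = of_word u"
| "shuffle_word (a # u) (b # v) =
     of_word [a] * shuffle_word u (b # v) +
     ((- 1) ^ length (a # u) * \<q> powi (\<Sum>c\<leftarrow>a # u. \<langle>c, b\<rangle>)) \<cdot>
       (of_word [b] * shuffle_word (a # u) v)"

definition shuffle :: "free_alg \<Rightarrow> free_alg \<Rightarrow> free_alg" (infixl \<open>\<star>\<close> 72) where
  "p \<star> r = (\<Sum>u\<in>Poly_Mapping.keys p. \<Sum>v\<in>Poly_Mapping.keys r.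
     (Poly_Mapping.lookup p u * Poly_Mapping.lookup r v) \<cdot> shuffle_word u v)"

fun weight :: "letter \<Rightarrow> int" where
  "weight X = 1"
| "weight Y = - 1"

abbreviation total_weight :: "word \<Rightarrow> int" where
  "total_weight w \<equiv> \<Sum>a\<leftarrow>w. weight a"

definition catalan_word :: "word \<Rightarrow> bool" where
  "catalan_word w \<longleftrightarrow> total_weight w = 0 \<and> (\<forall>i\<in>{1..length w}. total_weight (take i w) \<ge> 0)"

definition Cat :: "nat \<Rightarrow> word set" where
  "Cat n = {w. length w = 2 * n \<and> catalan_word w}"

lemma finite_Cat: "finite (Cat n)"
proof (rule finite_subset)
  have UNIV_letter: "(UNIV :: letter set) = {X, Y}"
    using letter.exhaust by auto
  show "finite {w :: word. set w \<subseteq> UNIV \<and> length w = 2 * n}"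
    by (rule finite_lists_length_eq) (simp add: UNIV_letter)
qed (auto simp: Cat_def)

(* cat_coeff n w is the coefficient attached to a word w in Cat n, and vanishes
   at every other word. *)

fun cat_coeff :: "nat \<Rightarrow> word \<Rightarrow> scalar" where
  "cat_coeff 0 w = (if w = [] then 1 else 0)"
| "cat_coeff (Suc n) w =
     (\<Sum>v\<in>Cat n. cat_coeff n v *
        (\<Sum>i | i \<le> length v \<and> w = take i v @ [X] @ drop i v @ [Y].
           (- 1) ^ i * {2 + 2 * total_weight (take i v)}\<^sub>q))"

definition catalan_elem :: "nat \<Rightarrow> free_alg" (\<open>C\<^sup>s\<close>) where
  "C\<^sup>s n = (\<Sum>w\<in>Cat n. Poly_Mapping.single w (cat_coeff n w))"

end

theory Submission
  imports Defs "HOL-Library.Function_Algebras"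
begin

text \<open>
Moving a letter \<open>b\<close> past a letter \<open>a\<close> costs \<open>- q\<^sup>2\<close> if \<open>a = b\<close> and \<open>- q\<^sup>-\<^sup>2\<close> otherwise, once the sign of
the superproduct is included. With \<open>t = - q\<^sup>2\<close> these are \<open>t\<close> and \<open>1 / t\<close>, so \<open>\<star>\<close> is the ordinary quantum
shuffle product with parameter \<open>t\<close>. The signed brackets in the recursion for the Catalan coefficients
are likewise \<open>t\<^sup>k - t\<^sup>-\<^sup>k\<close> up to a constant. The relations are therefore proved over an arbitrary
field with a parameter \<open>t\<close>; all of them follow from
\[ t (A_{i+1} \star A_j + A_{j+1} \star A_i) = A_j \star A_{i+1} + A_i \star A_{j+1}, \qquad A_i = x C_i, \]
from its half for \<open>i = j\<close>, and from the images of both under the antiautomorphism that reverses words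
and exchanges \<open>x\<close> and \<open>y\<close>.

Read a word as a lattice path, \<open>x\<close> going up and \<open>y\<close> going down. Let \<open>G\<^sub>h\<^sub>k\<close> be the sum of all words
leading from height \<open>h\<close> to height \<open>k\<close>, where a step down from height \<open>j\<close> carries the weight
\<open>\<Sum>\<^sub>i\<^sub>\<le>\<^sub>j (t\<^sup>i - t\<^sup>-\<^sup>i)\<close>. Up to normalisation \<open>C\<^sub>n\<close> is the part of length \<open>2n\<close> of \<open>G\<^sub>0\<^sub>0\<close>
(\<open>cat_coeff_eq\<close>). These path series obey simple exchange rules with the single letters
(\<open>y_qshuffle_paths\<close>, \<open>x_qshuffle_paths\<close>), because the weights of steps down from consecutive heights
differ by \<open>t\<^sup>i - t\<^sup>-\<^sup>i\<close>. Now \<open>C\<^sub>1\<close> is the polynomial \<open>t x \<star> y - y \<star> x\<close> in the letters, so commutators with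
\<open>C\<^sub>1\<close> can be computed by moving letters through \<open>G\<^sub>h\<^sub>k\<close>. This yields three facts:
\<open>C\<^sub>1\<close> commutes with every \<open>C\<^sub>n\<close>; \<open>[C\<^sub>1, A\<^sub>n]\<close> is a nonzero multiple of \<open>A\<^sub>n\<^sub>+\<^sub>1\<close>; and
\<open>[C\<^sub>1, G\<^sub>0\<^sub>1] = [C\<^sub>n\<^sub>+\<^sub>1, x]\<close> for the part of \<open>G\<^sub>0\<^sub>1\<close> of length \<open>2n + 1\<close>.

Together they give the exchange relation
\[ t\, C_{i+1} \star A_j - C_i \star A_{j+1} = t\, A_j \star C_{i+1} - t^2 A_{j+1} \star C_i. \]
The case \<open>j = 0\<close> is a computation with letters, and taking the commutator with \<open>C\<^sub>1\<close> raises \<open>j\<close> by one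
(\<open>catalan_x_catalan_exchange\<close>). Finally every word in the quadratic relation for \<open>A\<^sub>i\<close> and \<open>A\<^sub>j\<close> begins
with \<open>x\<close>, and deleting this \<open>x\<close> turns the relation into the sum of the exchange relations for \<open>(i, j)\<close>
and \<open>(j, i)\<close> (\<open>x_catalan_relation\<close>).
\<close>

section \<open>Formal series of words\<close>

text \<open>
An element of the free algebra is handled through its coefficient function. Two such functions agree
if they agree at the empty word and after stripping the first letter (or the last letter) of every
word, so that identities can be proved by comparing quotients.
\<close>

type_synonym 'a series = "word \<Rightarrow> 'a"

definition prefix_quot :: "letter \<Rightarrow> 'a series \<Rightarrow> 'a series" where
  "prefix_quot a f = (\<lambda>w. f (a # w))"

definition suffix_quot :: "letter \<Rightarrow> 'a series \<Rightarrow> 'a series" where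
  "suffix_quot a f = (\<lambda>w. f (w @ [a]))"

definition smul :: "'a::times \<Rightarrow> 'a series \<Rightarrow> 'a series" (infixr \<open>\<odot>\<close> 75) where
  "c \<odot> f = (\<lambda>w. c * f w)"

definition word_series :: "word \<Rightarrow> 'a::zero_neq_one series" where
  "word_series u = (\<lambda>w. if w = u then 1 else 0)"

fun prepend_letter :: "letter \<Rightarrow> 'a::zero series \<Rightarrow> 'a series" where
  "prepend_letter a f [] = 0"
| "prepend_letter a f (b # w) = (if a = b then f w else 0)"

definition append_letter :: "letter \<Rightarrow> 'a::zero series \<Rightarrow> 'a series" where
  "append_letter a f w = (if w \<noteq> [] \<and> last w = a then f (butlast w) else 0)"

lemma smul_apply [simp]: "(c \<odot> f) w = c * f w"
  by (simp add: smul_def)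

lemma smul_simps:
  fixes f g :: "'a::comm_ring_1 series"
  shows "c \<odot> (f + g) = c \<odot> f + c \<odot> g" "c \<odot> (f - g) = c \<odot> f - c \<odot> g"
    "c \<odot> (- f) = - (c \<odot> f)" "c \<odot> 0 = (0 :: 'a series)" "c \<odot> d \<odot> f = (c * d) \<odot> f"
    "(c + d) \<odot> f = c \<odot> f + d \<odot> f" "1 \<odot> f = f" "0 \<odot> f = 0"
  by (simp_all add: fun_eq_iff algebra_simps)

lemma prefix_quot_simps [simp]:
  fixes f g :: "'a::comm_ring_1 series"
  shows "prefix_quot a (f + g) = prefix_quot a f + prefix_quot a g"
    "prefix_quot a (f - g) = prefix_quot a f - prefix_quot a g"
    "prefix_quot a (- f) = - prefix_quot a f"
    "prefix_quot a (c \<odot> f) = c \<odot> prefix_quot a f"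
    "prefix_quot a (0 :: 'a series) = 0"
    "prefix_quot a (word_series [] :: 'a series) = 0"
    "prefix_quot a (word_series (b # u)) = (if a = b then word_series u else (0 :: 'a series))"
    "prefix_quot a (prepend_letter b f) = (if a = b then f else 0)"
  by (auto simp: prefix_quot_def word_series_def fun_eq_iff)

lemma suffix_quot_simps [simp]:
  fixes f g :: "'a::comm_ring_1 series"
  shows "suffix_quot a (f + g) = suffix_quot a f + suffix_quot a g"
    "suffix_quot a (f - g) = suffix_quot a f - suffix_quot a g"
    "suffix_quot a (c \<odot> f) = c \<odot> suffix_quot a f"
    "suffix_quot a (word_series [b]) = (if a = b then word_series [] else (0 :: 'a series))"
    "suffix_quot a (append_letter b f) = (if a = b then f else 0)"
  by (auto simp: suffix_quot_def word_series_def fun_eq_iff append_letter_def)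

lemma series_eqI_prefix:
  assumes "f [] = g []" "\<And>a. prefix_quot a f = prefix_quot a g"
  shows "f = g"
proof
  fix w show "f w = g w"
    using assms by (cases w) (auto simp: prefix_quot_def fun_eq_iff)
qed

lemma series_eqI_suffix:
  assumes "f [] = g []" "\<And>a. suffix_quot a f = suffix_quot a g"
  shows "f = g"
proof
  fix w show "f w = g w"
    using assms by (cases w rule: rev_cases) (auto simp: suffix_quot_def fun_eq_iff)
qed

fun swap :: "letter \<Rightarrow> letter" where
  "swap X = Y"
| "swap Y = X"

lemma swap_swap [simp]: "swap (swap a) = a"
  by (cases a) auto

lemma swap_eq_iff: "swap a = b \<longleftrightarrow> a = swap b"
  by auto

definition reflect :: "'a series \<Rightarrow> 'a series" where
  "reflect f = (\<lambda>w. f (rev (map swap w)))"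

lemma prefix_quot_reflect: "prefix_quot a (reflect f) = reflect (suffix_quot (swap a) f)"
  by (simp add: reflect_def prefix_quot_def suffix_quot_def)

lemma reflect_prepend: "reflect (prepend_letter X f) = append_letter Y (reflect f)"
proof
  fix w show "reflect (prepend_letter X f) w = append_letter Y (reflect f) w"
    by (cases w rule: rev_cases) (auto simp: reflect_def append_letter_def swap_eq_iff[symmetric])
qed

lemma reflect_word_series:
  "reflect (word_series [X]) = word_series [Y]" "reflect (word_series [Y]) = word_series [X]"
  by (auto simp: reflect_def word_series_def fun_eq_iff map_eq_Cons_conv swap_eq_iff
      rev_swap)

lemma reflect_linear [simp]:
  fixes f g :: "'a::comm_ring_1 series"
  shows "reflect (f + g) = reflect f + reflect g" "reflect (f - g) = reflect f - reflect g"
    "reflect (c \<odot> f) = c \<odot> reflect f"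
  by (simp_all add: reflect_def fun_eq_iff)

section \<open>The quantum shuffle product\<close>

text \<open>
The braiding coefficient of two letters is \<open>t\<close> if they are equal and \<open>1 / t\<close> otherwise. The product is
defined by recursion on the word at which it is evaluated: its first letter \<open>a\<close> comes either from the
left factor, or from the right factor after having moved past the whole left word. The cost of this
move is recorded by \<open>twist a\<close>.
\<close>

locale quantum_shuffle =
  fixes t :: "'a::field"
  assumes t_nonzero [simp]: "t \<noteq> 0"
begin

abbreviation s :: 'a where "s \<equiv> inverse t"

definition braid :: "letter \<Rightarrow> letter \<Rightarrow> 'a" where
  "braid c a = (if c = a then t else s)"

lemma braid_commute: "braid c a = braid a c"
  by (simp add: braid_def)

definition twist :: "letter \<Rightarrow> 'a series \<Rightarrow> 'a series" where
  "twist a f = (\<lambda>u. (\<Prod>c\<leftarrow>u. braid c a) * f u)"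

primrec qshuffle :: "'a series \<Rightarrow> 'a series \<Rightarrow> 'a series" (infixl \<open>\<bowtie>\<close> 72) where
  "qshuffle f g [] = f [] * g []"
| "qshuffle f g (a # w) =
     qshuffle (prefix_quot a f) g w + qshuffle (twist a f) (prefix_quot a g) w"

lemma twist_simps [simp]:
  "twist a (f + g) = twist a f + twist a g"
  "twist a (f - g) = twist a f - twist a g"
  "twist a (- f) = - twist a f"
  "twist a (c \<odot> f) = c \<odot> twist a f"
  "twist a 0 = 0"
  "twist a (word_series u) = (\<Prod>c\<leftarrow>u. braid c a) \<odot> word_series u"
  "twist a f [] = f []"
  by (auto simp: twist_def fun_eq_iff algebra_simps word_series_def)

lemma twist_prefix_quot: "prefix_quot a (twist b f) = braid a b \<odot> twist b (prefix_quot a f)"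
  by (simp add: twist_def prefix_quot_def fun_eq_iff)

lemma twist_suffix_quot: "suffix_quot a (twist b f) = braid a b \<odot> twist b (suffix_quot a f)"
  by (simp add: twist_def suffix_quot_def fun_eq_iff)

lemma twist_prepend_letter:
  "twist a (prepend_letter b f) = braid b a \<odot> prepend_letter b (twist a f)"
proof
  show "twist a (prepend_letter b f) w = (braid b a \<odot> prepend_letter b (twist a f)) w" for w
    by (cases w) (auto simp: twist_def)
qed

lemma twist_commute: "twist a (twist b f) = twist b (twist a f)"
  by (simp add: twist_def fun_eq_iff)

lemma prefix_quot_qshuffle:
  "prefix_quot a (f \<bowtie> g) = prefix_quot a f \<bowtie> g + twist a f \<bowtie> prefix_quot a g"
  by (simp add: fun_eq_iff prefix_quot_def[of a "qshuffle f g"])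

lemma qshuffle_bilinear:
  "(f + f') \<bowtie> g = f \<bowtie> g + f' \<bowtie> g" "f \<bowtie> (g + g') = f \<bowtie> g + f \<bowtie> g'"
  "(f - f') \<bowtie> g = f \<bowtie> g - f' \<bowtie> g" "f \<bowtie> (g - g') = f \<bowtie> g - f \<bowtie> g'"
  "(- f) \<bowtie> g = - (f \<bowtie> g)" "f \<bowtie> (- g) = - (f \<bowtie> g)"
  "(c \<odot> f) \<bowtie> g = c \<odot> (f \<bowtie> g)" "f \<bowtie> (c \<odot> g) = c \<odot> (f \<bowtie> g)"
  "0 \<bowtie> g = 0" "f \<bowtie> 0 = 0"
proof -
  have "((f + f') \<bowtie> g) w = (f \<bowtie> g + f' \<bowtie> g) w" "(f \<bowtie> (g + g')) w = (f \<bowtie> g + f \<bowtie> g') w"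
    "((f - f') \<bowtie> g) w = (f \<bowtie> g - f' \<bowtie> g) w" "(f \<bowtie> (g - g')) w = (f \<bowtie> g - f \<bowtie> g') w"
    "((- f) \<bowtie> g) w = (- (f \<bowtie> g)) w" "(f \<bowtie> (- g)) w = (- (f \<bowtie> g)) w"
    "((c \<odot> f) \<bowtie> g) w = (c \<odot> (f \<bowtie> g)) w" "(f \<bowtie> (c \<odot> g)) w = (c \<odot> (f \<bowtie> g)) w"
    "(0 \<bowtie> g) w = 0" "(f \<bowtie> 0) w = 0" for w
    by (induction w arbitrary: f f' g g') (auto simp: algebra_simps)
  then show "(f + f') \<bowtie> g = f \<bowtie> g + f' \<bowtie> g" "f \<bowtie> (g + g') = f \<bowtie> g + f \<bowtie> g'"
    "(f - f') \<bowtie> g = f \<bowtie> g - f' \<bowtie> g" "f \<bowtie> (g - g') = f \<bowtie> g - f \<bowtie> g'"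
    "(- f) \<bowtie> g = - (f \<bowtie> g)" "f \<bowtie> (- g) = - (f \<bowtie> g)"
    "(c \<odot> f) \<bowtie> g = c \<odot> (f \<bowtie> g)" "f \<bowtie> (c \<odot> g) = c \<odot> (f \<bowtie> g)"
    "0 \<bowtie> g = 0" "f \<bowtie> 0 = 0"
    by (simp_all add: fun_eq_iff)
qed

lemma twist_qshuffle: "twist a (f \<bowtie> g) = twist a f \<bowtie> twist a g"
proof
  fix w show "twist a (f \<bowtie> g) w = (twist a f \<bowtie> twist a g) w"
  proof (induction w arbitrary: f g)
    case (Cons b w)
    have "twist a (f \<bowtie> g) (b # w) = braid b a * twist a (prefix_quot b (f \<bowtie> g)) w"
      by (simp add: twist_def prefix_quot_def)
    with Cons show ?case
      by (simp add: prefix_quot_qshuffle qshuffle_bilinear twist_prefix_quot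
          twist_commute[of b a] algebra_simps)
  qed simp
qed

lemma qshuffle_assoc: "f \<bowtie> (g \<bowtie> h) = f \<bowtie> g \<bowtie> h"
proof
  fix w show "(f \<bowtie> (g \<bowtie> h)) w = (f \<bowtie> g \<bowtie> h) w"
    by (induction w arbitrary: f g h)
      (simp_all add: prefix_quot_qshuffle twist_qshuffle qshuffle_bilinear)
qed

text \<open>
The mirror image of the defining recursion: a last letter coming from the left factor has been passed
by the whole right word.
\<close>

lemma suffix_quot_qshuffle:
  "suffix_quot a (f \<bowtie> g) = f \<bowtie> suffix_quot a g + suffix_quot a f \<bowtie> twist a g"
proof
  fix w
  show "suffix_quot a (f \<bowtie> g) w = (f \<bowtie> suffix_quot a g + suffix_quot a f \<bowtie> twist a g) w"
  proof (induction w arbitrary: f g)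
    case Nil
    show ?case by (simp add: suffix_quot_def prefix_quot_def)
  next
    case (Cons b w)
    have comm: "suffix_quot a (prefix_quot b h) = prefix_quot b (suffix_quot a h)"
      for h :: "'a series"
      by (simp add: suffix_quot_def prefix_quot_def fun_eq_iff)
    have "suffix_quot a (f \<bowtie> g) (b # w) = suffix_quot a (prefix_quot b (f \<bowtie> g)) w"
      by (simp add: suffix_quot_def prefix_quot_def)
    also have "\<dots> = (suffix_quot a (prefix_quot b f \<bowtie> g) + suffix_quot a (twist b f \<bowtie> prefix_quot b g)) w"
      by (simp add: prefix_quot_qshuffle)
    also have "\<dots> = (prefix_quot b f \<bowtie> suffix_quot a g + prefix_quot b (suffix_quot a f) \<bowtie> twist a g
        + (twist b f \<bowtie> prefix_quot b (suffix_quot a g)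
          + braid a b \<odot> (twist b (suffix_quot a f) \<bowtie> twist a (prefix_quot b g)))) w"
      unfolding suffix_quot_simps plus_fun_apply Cons comm twist_suffix_quot qshuffle_bilinear ..
    finally show ?case
      by (simp add: twist_prefix_quot qshuffle_bilinear braid_commute[of b a])
  qed
qed

lemma twist_reflect: "twist a (reflect f) = reflect (twist (swap a) f)"
proof
  fix w
  have "(\<Prod>c\<leftarrow>map swap w. braid c (swap a)) = (\<Prod>c\<leftarrow>w. braid c a)"
    by (induction w) (auto simp: braid_def swap_eq_iff)
  then show "twist a (reflect f) w = reflect (twist (swap a) f) w"
    by (simp add: twist_def reflect_def rev_map[symmetric] prod_list.rev)
qed

text \<open>
A pair of letters is crossed in a shuffle of \<open>f\<close> and \<open>g\<close> exactly if its mirror image is crossed in the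
reversed word, seen as a shuffle of the reversed words in the opposite order; and exchanging the two
letters preserves the braiding.
\<close>

lemma reflect_qshuffle: "reflect (f \<bowtie> g) = reflect g \<bowtie> reflect f"
proof
  fix w show "reflect (f \<bowtie> g) w = (reflect g \<bowtie> reflect f) w"
  proof (induction w arbitrary: f g)
    case (Cons a w)
    have "reflect (f \<bowtie> g) (a # w) = reflect (suffix_quot (swap a) (f \<bowtie> g)) w"
      by (simp flip: prefix_quot_reflect) (simp add: prefix_quot_def)
    then show ?case
      by (simp add: suffix_quot_qshuffle Cons prefix_quot_reflect twist_reflect)
  qed (simp add: reflect_def)
qed

section \<open>Path series and their exchange with the letters\<close>

abbreviation \<xi> where "\<xi> \<equiv> word_series [X] :: 'a series"
abbreviation \<eta> where "\<eta> \<equiv> word_series [Y] :: 'a series"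

text \<open>
For \<open>t = p\<^sup>2\<close>, \<open>p\<^sup>2 \<noteq> 1\<close>, and \<open>[n] = (p\<^sup>n - p\<^sup>-\<^sup>n) / (p - p\<^sup>-\<^sup>1)\<close>, this is \<open>(p - p\<^sup>-\<^sup>1) [h] [h + 1]\<close>.
It weights a step down from height \<open>h\<close>. The familiar product of \<open>[1 + height]\<close> over all steps of a
Catalan path is obtained by charging the step up that reaches height \<open>h\<close> to a matching step down.
\<close>

primrec fall :: "nat \<Rightarrow> 'a" where
  "fall 0 = 0"
| "fall (Suc h) = fall h + t ^ Suc h - s ^ Suc h"

text \<open>
The weight of a word as a path from height \<open>h\<close> to height \<open>k\<close>. A path below the axis has weight \<open>0\<close>:
since \<open>fall 0 = 0\<close>, the value of \<open>h - 1\<close> at \<open>h = 0\<close> does not matter.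
\<close>

fun path_weight :: "nat \<Rightarrow> nat \<Rightarrow> word \<Rightarrow> 'a" where
  "path_weight h k [] = (if h = k then 1 else 0)"
| "path_weight h k (X # w) = path_weight (Suc h) k w"
| "path_weight h k (Y # w) = fall h * path_weight (h - 1) k w"

definition paths :: "nat \<Rightarrow> nat \<Rightarrow> nat \<Rightarrow> 'a series" where
  "paths n h k w = (if length w = n then path_weight h k w else 0)"

text \<open>
The paths that end one step below \<open>k\<close>; there are none for \<open>k = 0\<close>.
\<close>

definition paths_below :: "nat \<Rightarrow> nat \<Rightarrow> nat \<Rightarrow> 'a series" where
  "paths_below n h k = (case k of 0 \<Rightarrow> 0 | Suc k' \<Rightarrow> paths n h k')"

lemma path_weight_snoc [simp]:
  "path_weight h k (w @ [X]) = (case k of 0 \<Rightarrow> 0 | Suc k' \<Rightarrow> path_weight h k' w)"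
  "path_weight h k (w @ [Y]) = fall (Suc k) * path_weight h (Suc k) w"
proof -
  have "path_weight h k (w @ [X]) = (case k of 0 \<Rightarrow> 0 | Suc k' \<Rightarrow> path_weight h k' w)
    \<and> path_weight h k (w @ [Y]) = fall (Suc k) * path_weight h (Suc k) w"
  proof (induction w arbitrary: h)
    case Nil
    then show ?case by (cases h) (auto split: nat.splits)
  next
    case (Cons a w)
    then show ?case by (cases a) (auto split: nat.splits simp del: fall.simps)
  qed
  then show "path_weight h k (w @ [X]) = (case k of 0 \<Rightarrow> 0 | Suc k' \<Rightarrow> path_weight h k' w)"
  "path_weight h k (w @ [Y]) = fall (Suc k) * path_weight h (Suc k) w"
    by blast+
qed

lemma paths_simps [simp]:
  "paths 0 h k = (if h = k then word_series [] else 0)"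
  "paths (Suc n) h k [] = 0"
  "prefix_quot X (paths (Suc n) h k) = paths n (Suc h) k"
  "prefix_quot Y (paths (Suc n) h k) = fall h \<odot> paths n (h - 1) k"
  "suffix_quot X (paths (Suc n) h k) = (case k of 0 \<Rightarrow> 0 | Suc k' \<Rightarrow> paths n h k')"
  "suffix_quot Y (paths (Suc n) h k) = fall (Suc k) \<odot> paths n h (Suc k)"
  by (auto simp: paths_def fun_eq_iff word_series_def prefix_quot_def suffix_quot_def split: nat.splits)

lemma paths_below_simps [simp]:
  "paths_below n h 0 = 0"
  "paths_below n h (Suc k) = paths n h k"
  "paths_below (Suc n) h k [] = 0"
  "prefix_quot X (paths_below (Suc n) h k) = paths_below n (Suc h) k"
  "prefix_quot Y (paths_below (Suc n) h k) = fall h \<odot> paths_below n (h - 1) k"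
  by (auto simp: paths_below_def smul_simps split: nat.splits)

text \<open>
A word leading from \<open>h\<close> to \<open>k\<close> has \<open>k - h\<close> more letters \<open>X\<close> than letters \<open>Y\<close>, which determines the cost
of moving a letter past it.
\<close>

lemma twist_paths:
  "twist X (paths n h k) = (t ^ k * s ^ h) \<odot> paths n h k"
  "twist Y (paths n h k) = (t ^ h * s ^ k) \<odot> paths n h k"
proof -
  have *: "path_weight h k w = 0 \<or>
    t ^ h * (\<Prod>c\<leftarrow>w. braid c X) = t ^ k \<and> t ^ k * (\<Prod>c\<leftarrow>w. braid c Y) = t ^ h" for w
  proof (induction w arbitrary: h)
    case (Cons a w)
    show ?case
    proof (cases a)
      case X
      with Cons[of "Suc h"] show ?thesis by (auto simp: braid_def field_simps)
    next
      case Y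
      with Cons[of "h - 1"] show ?thesis
        by (cases h) (auto simp: braid_def field_simps simp del: fall.simps(2))
    qed
  qed auto
  show "twist X (paths n h k) = (t ^ k * s ^ h) \<odot> paths n h k"
    "twist Y (paths n h k) = (t ^ h * s ^ k) \<odot> paths n h k"
    using * by (auto simp: fun_eq_iff twist_def paths_def field_simps)
qed

lemma qshuffle_one [simp]: "word_series [] \<bowtie> f = f" "f \<bowtie> word_series [] = f"
proof -
  have "(word_series [] \<bowtie> f) w = f w \<and> (f \<bowtie> word_series []) w = f w" for w
  proof (induction w arbitrary: f)
    case Nil
    show ?case by (simp add: word_series_def)
  next
    case (Cons a w)
    then show ?case
      by (simp add: qshuffle_bilinear smul_simps) (simp add: prefix_quot_def)
  qed
  then show "word_series [] \<bowtie> f = f" "f \<bowtie> word_series [] = f"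
    by (simp_all add: fun_eq_iff)
qed

text \<open>
The letter \<open>Y\<close> can be pulled through a path series at the price of shifted path series of length one
more. In the induction on the first letter of the word, a letter \<open>X\<close> only shifts \<open>h\<close>, and a letter \<open>Y\<close>
leaves the identity \<open>fall (h + 1) - fall h = t ^ (h + 1) - s ^ (h + 1)\<close>, which is the reason for the
choice of \<open>fall\<close>.
\<close>

lemma y_qshuffle_paths:
  "\<eta> \<bowtie> paths n h k = t ^ (2 + h + k) \<odot> (paths n h k \<bowtie> \<eta>)
     - t ^ (1 + h) \<odot> (paths (Suc n) (Suc h) k - paths_below (Suc n) h k)"
proof (induction n arbitrary: h)
  case 0
  show ?case
  proof (rule series_eqI_prefix)
    fix a
    show "prefix_quot a (\<eta> \<bowtie> paths 0 h k) = prefix_quot a (t ^ (2 + h + k) \<odot> (paths 0 h k \<bowtie> \<eta>)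
     - t ^ (1 + h) \<odot> (paths (Suc 0) (Suc h) k - paths_below (Suc 0) h k))"
      by (cases a; cases k; cases h; auto simp: prefix_quot_qshuffle qshuffle_bilinear smul_simps;
          auto simp: fun_eq_iff field_simps power2_eq_square power_add le_Suc_eq)
  qed (auto simp: word_series_def)
next
  case (Suc n)
  show ?case
  proof (rule series_eqI_prefix)
    fix a
    show "prefix_quot a (\<eta> \<bowtie> paths (Suc n) h k) = prefix_quot a (t ^ (2 + h + k) \<odot> (paths (Suc n) h k \<bowtie> \<eta>)
     - t ^ (1 + h) \<odot> (paths (Suc (Suc n)) (Suc h) k - paths_below (Suc (Suc n)) h k))"
    proof (cases a)
      case X
      then show ?thesis
        by (simp add: prefix_quot_qshuffle qshuffle_bilinear Suc braid_def fun_eq_iff field_simps)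
    next
      case Y
      then show ?thesis
        by (cases h; simp add: prefix_quot_qshuffle qshuffle_bilinear Suc braid_def smul_simps twist_paths;
            simp add: fun_eq_iff field_simps power_add power3_eq_cube)
    qed
  qed auto
qed

text \<open>
The counterpart for the letter \<open>X\<close>. Here the same identity for \<open>fall\<close> is what remains when the first
letter of the word is \<open>X\<close>.
\<close>

lemma x_qshuffle_paths:
  "\<xi> \<bowtie> paths n h k = s ^ (2 + h + k) \<odot> (paths n h k \<bowtie> \<xi>)
     + s ^ (1 + h) \<odot> (fall (Suc k) \<odot> paths (Suc n) h (Suc k) - fall h \<odot> paths (Suc n) (h - 1) k)"
proof (induction n arbitrary: h)
  case 0
  show ?case
  proof (rule series_eqI_prefix)
    fix a
    show "prefix_quot a (\<xi> \<bowtie> paths 0 h k) = prefix_quot a (s ^ (2 + h + k) \<odot> (paths 0 h k \<bowtie> \<xi>)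
     + s ^ (1 + h) \<odot> (fall (Suc k) \<odot> paths (Suc 0) h (Suc k) - fall h \<odot> paths (Suc 0) (h - 1) k))"
      by (cases a; cases k; cases h; auto simp: prefix_quot_qshuffle qshuffle_bilinear smul_simps;
          auto simp: fun_eq_iff field_simps power2_eq_square power_add le_Suc_eq)
  qed (auto simp: word_series_def)
next
  case (Suc n)
  show ?case
  proof (rule series_eqI_prefix)
    fix a
    show "prefix_quot a (\<xi> \<bowtie> paths (Suc n) h k) = prefix_quot a (s ^ (2 + h + k) \<odot> (paths (Suc n) h k \<bowtie> \<xi>)
     + s ^ (1 + h) \<odot> (fall (Suc k) \<odot> paths (Suc (Suc n)) h (Suc k) - fall h \<odot> paths (Suc (Suc n)) (h - 1) k))"
    proof (cases a)
      case X
      then show ?thesis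
        by (cases h; simp add: prefix_quot_qshuffle qshuffle_bilinear Suc braid_def smul_simps twist_paths;
            simp add: fun_eq_iff field_simps power_add power3_eq_cube)
    next
      case Y
      then show ?thesis
        by (cases h; simp add: prefix_quot_qshuffle qshuffle_bilinear Suc braid_def smul_simps;
            simp add: fun_eq_iff field_simps power_add power3_eq_cube)
    qed
  qed auto
qed

section \<open>Quadratic relations of the Catalan series\<close>

definition catalan :: "nat \<Rightarrow> 'a series" where
  "catalan n = paths (2 * n) 0 0"

definition x_catalan :: "nat \<Rightarrow> 'a series" where
  "x_catalan n = prepend_letter X (catalan n)"

definition catalan_y :: "nat \<Rightarrow> 'a series" where
  "catalan_y n = append_letter Y (catalan n)"

lemma catalan_0 [simp]: "catalan 0 = word_series []"
  by (simp add: catalan_def)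

lemma twist_catalan [simp]: "twist a (catalan n) = catalan n"
  by (cases a) (simp_all add: catalan_def twist_paths smul_simps)

lemma x_catalan_simps [simp]:
  "x_catalan n [] = 0"
  "prefix_quot X (x_catalan n) = catalan n"
  "prefix_quot Y (x_catalan n) = 0"
  "twist a (x_catalan n) = braid X a \<odot> x_catalan n"
  by (simp_all add: x_catalan_def twist_prepend_letter smul_simps)

abbreviation commutator :: "'a series \<Rightarrow> 'a series \<Rightarrow> 'a series" where
  "commutator f g \<equiv> f \<bowtie> g - g \<bowtie> f"

lemma prefix_quot_catalan [simp]:
  "prefix_quot X (catalan (Suc n)) = paths (Suc (2 * n)) (Suc 0) 0"
  "prefix_quot Y (catalan (Suc n)) = 0"
  "catalan (Suc n) [] = 0"
  by (simp_all add: catalan_def smul_simps)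

text \<open>
Only words beginning with \<open>X\<close> survive, and stripping this letter leaves the exchange rule for \<open>\<eta>\<close> at
height \<open>0\<close>.
\<close>

lemma q_commutator_y_x_catalan:
  "\<eta> \<bowtie> x_catalan n - t \<odot> (x_catalan n \<bowtie> \<eta>) = - catalan (Suc n)"
proof (rule series_eqI_prefix)
  have "\<eta> \<bowtie> catalan n = t\<^sup>2 \<odot> (catalan n \<bowtie> \<eta>) - t \<odot> paths (Suc (2 * n)) (Suc 0) 0"
    by (simp add: catalan_def y_qshuffle_paths numeral_2_eq_2)
  then show "prefix_quot a (\<eta> \<bowtie> x_catalan n - t \<odot> (x_catalan n \<bowtie> \<eta>)) = prefix_quot a (- catalan (Suc n))" for a
    by (cases a)
      (simp_all add: prefix_quot_qshuffle qshuffle_bilinear smul_simps braid_def power2_eq_square,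
        simp_all add: fun_eq_iff)
qed simp

lemma x_catalan_0 [simp]: "x_catalan 0 = \<xi>"
proof (rule series_eqI_prefix)
  show "prefix_quot a (x_catalan 0) = prefix_quot a \<xi>" for a
    by (cases a) simp_all
qed (simp add: word_series_def)

lemma catalan_1: "catalan 1 = t \<odot> (\<xi> \<bowtie> \<eta>) - \<eta> \<bowtie> \<xi>"
  using q_commutator_y_x_catalan[of 0] unfolding x_catalan_0 by (simp add: algebra_simps)

text \<open>
The two associativity rules serve to move \<open>\<xi>\<close> and \<open>\<eta>\<close> from the left of a path series to its right: the
first exposes the innermost product to the exchange rules, the second brings the result into the normal
form of a path series followed by letters.
\<close>

lemma qshuffle_assoc_expand:
  "\<xi> \<bowtie> \<eta> \<bowtie> f = \<xi> \<bowtie> (\<eta> \<bowtie> f)" "\<eta> \<bowtie> \<xi> \<bowtie> f = \<eta> \<bowtie> (\<xi> \<bowtie> f)"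
  by (simp_all add: qshuffle_assoc)

lemma qshuffle_assoc_collect:
  "\<xi> \<bowtie> (f \<bowtie> \<eta>) = \<xi> \<bowtie> f \<bowtie> \<eta>" "\<eta> \<bowtie> (f \<bowtie> \<xi>) = \<eta> \<bowtie> f \<bowtie> \<xi>"
  "f \<bowtie> (\<xi> \<bowtie> \<eta>) = f \<bowtie> \<xi> \<bowtie> \<eta>" "f \<bowtie> (\<eta> \<bowtie> \<xi>) = f \<bowtie> \<eta> \<bowtie> \<xi>"
  by (simp_all add: qshuffle_assoc)

text \<open>
Moving \<open>\<xi> \<bowtie> \<eta>\<close> and \<open>\<eta> \<bowtie> \<xi>\<close> through \<open>catalan n\<close> produces the same error terms up to the factor \<open>t\<close>, and
these cancel in the combination \<open>catalan 1\<close>.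
\<close>

lemma catalan_1_commutes: "commutator (catalan 1) (catalan n) = 0"
  unfolding catalan_1 unfolding catalan_def
  by (simp add: qshuffle_bilinear qshuffle_assoc_expand x_qshuffle_paths y_qshuffle_paths qshuffle_assoc_collect smul_simps)
    (simp add: fun_eq_iff field_simps eval_nat_numeral)

lemma commutator_catalan_x:
  "commutator (catalan n) \<xi> = (1 - s ^ 2) \<odot> (catalan n \<bowtie> \<xi> - paths (Suc (2 * n)) 0 1)"
  unfolding catalan_def
  by (simp add: x_qshuffle_paths smul_simps) (simp add: fun_eq_iff field_simps power2_eq_square)

text \<open>
For paths that end at height \<open>1\<close> the error terms no longer cancel. What remains of them is, by
\<open>commutator_catalan_x\<close>, again a commutator. This identity is the base of the exchange relation.
\<close>

lemma commutator_catalan_1_paths: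
  "commutator (catalan 1) (paths (Suc (2 * n)) 0 1) = commutator (catalan (Suc n)) \<xi>"
  unfolding commutator_catalan_x
  unfolding catalan_1 unfolding catalan_def
  by (simp add: qshuffle_bilinear qshuffle_assoc_expand x_qshuffle_paths y_qshuffle_paths qshuffle_assoc_collect smul_simps)
    (simp add: fun_eq_iff field_simps eval_nat_numeral)

lemma commutator_qshuffle: "commutator f (g \<bowtie> h) = commutator f g \<bowtie> h + g \<bowtie> commutator f h"
  by (simp add: qshuffle_bilinear qshuffle_assoc)

lemma commutator_linear:
  "commutator f (g - h) = commutator f g - commutator f h"
  "commutator f (c \<odot> g) = c \<odot> commutator f g"
  by (simp_all add: qshuffle_bilinear smul_simps)

text \<open>
Stripping the initial \<open>X\<close> removes the terms \<open>catalan 1 \<bowtie> catalan n - catalan n \<bowtie> catalan 1\<close> and leaves a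
multiple of the \<open>t\<close>-commutator of \<open>\<eta>\<close> with \<open>x_catalan n\<close>. Hence the commutator with \<open>catalan 1\<close> is a
derivation that kills every \<open>catalan n\<close> and raises the index of \<open>x_catalan n\<close>.
\<close>

lemma commutator_catalan_1_x_catalan:
  "commutator (catalan 1) (x_catalan n) = - ((t - s) \<odot> x_catalan (Suc n))"
proof (rule series_eqI_prefix)
  fix a
  have "(t - s) \<odot> (\<eta> \<bowtie> x_catalan n - t \<odot> (x_catalan n \<bowtie> \<eta>)) = - ((t - s) \<odot> catalan (Suc n))"
    unfolding q_commutator_y_x_catalan smul_simps ..
  moreover have "paths (Suc 0) (Suc 0) 0 = (t - s) \<odot> \<eta>"
  proof (rule series_eqI_prefix)
    show "prefix_quot a (paths (Suc 0) (Suc 0) 0) = prefix_quot a ((t - s) \<odot> \<eta>)" for a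
      by (cases a) (simp_all add: smul_simps)
  qed (simp add: word_series_def)
  ultimately show "prefix_quot a (commutator (catalan 1) (x_catalan n))
    = prefix_quot a (- ((t - s) \<odot> x_catalan (Suc n)))"
    using catalan_1_commutes[of n]
    by (cases a) (simp_all add: prefix_quot_qshuffle qshuffle_bilinear smul_simps braid_def
        algebra_simps)
qed simp

text \<open>
Up to a factor, \<open>x_catalan 1\<close> is the commutator of \<open>catalan 1\<close> with \<open>\<xi>\<close>. Since \<open>catalan 1\<close> commutes with
\<open>catalan i\<close>, its product with \<open>catalan i\<close> is the commutator of \<open>catalan 1\<close> with \<open>\<xi> \<bowtie> catalan i\<close>, which the
exchange rule for \<open>\<xi>\<close> and the two commutators above evaluate.
\<close>

lemma catalan_x_catalan_exchange_0:
  assumes "t\<^sup>2 \<noteq> 1"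
  shows "t \<odot> (catalan (Suc i) \<bowtie> \<xi>) - catalan i \<bowtie> x_catalan 1
    = t \<odot> (\<xi> \<bowtie> catalan (Suc i)) - t\<^sup>2 \<odot> (x_catalan 1 \<bowtie> catalan i)"
proof -
  define c where "c = t - s"
  have c_nonzero: "c \<noteq> 0"
    using assms by (simp add: c_def field_simps power2_eq_square)
  let ?E = "catalan 1" and ?C = "catalan i" and ?P = "paths (Suc (2 * i)) 0 1"
  have x_C: "\<xi> \<bowtie> ?C = s\<^sup>2 \<odot> (?C \<bowtie> \<xi>) + (s * c) \<odot> ?P"
    by (simp add: catalan_def x_qshuffle_paths numeral_2_eq_2 smul_simps c_def)
  \<comment> \<open>\<open>?E\<close> commutes with \<open>?C\<close>, so it may be moved to the other side of \<open>?C\<close>.\<close>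
  have "commutator ?E \<xi> \<bowtie> ?C = commutator ?E (\<xi> \<bowtie> ?C)"
    unfolding commutator_qshuffle catalan_1_commutes by (simp add: qshuffle_bilinear)
  also have "\<dots> = s\<^sup>2 \<odot> commutator ?E (?C \<bowtie> \<xi>) + (s * c) \<odot> commutator ?E ?P"
    unfolding x_C by (simp add: qshuffle_bilinear smul_simps)
  also have "\<dots> = s\<^sup>2 \<odot> (?C \<bowtie> commutator ?E \<xi>) + (s * c) \<odot> commutator (catalan (Suc i)) \<xi>"
    unfolding commutator_qshuffle catalan_1_commutes commutator_catalan_1_paths by (simp add: qshuffle_bilinear)
  finally have "(- (c \<odot> x_catalan 1) \<bowtie> ?C) w
    = (s\<^sup>2 \<odot> (?C \<bowtie> - (c \<odot> x_catalan 1)) + (s * c) \<odot> commutator (catalan (Suc i)) \<xi>) w" for w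
    using commutator_catalan_1_x_catalan[of 0, folded c_def] by (simp only: x_catalan_0 One_nat_def)
  then have "c * ((x_catalan 1 \<bowtie> ?C) w
    - s\<^sup>2 * (?C \<bowtie> x_catalan 1) w + s * commutator (catalan (Suc i)) \<xi> w) = 0" for w
    by (simp add: qshuffle_bilinear algebra_simps)
  then have "(x_catalan 1 \<bowtie> ?C) w
    - s\<^sup>2 * (?C \<bowtie> x_catalan 1) w + s * commutator (catalan (Suc i)) \<xi> w = 0" for w
    using c_nonzero by (metis mult_eq_0_iff)
  then have "t * (t \<odot> (catalan (Suc i) \<bowtie> \<xi>) - ?C \<bowtie> x_catalan 1) w
    = t * (t \<odot> (\<xi> \<bowtie> catalan (Suc i)) - t\<^sup>2 \<odot> (x_catalan 1 \<bowtie> ?C)) w" for w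
    by (simp add: field_simps power2_eq_square)
  then show ?thesis
    by (simp only: fun_eq_iff mult_left_cancel[OF t_nonzero]) simp
qed

text \<open>
The commutator with \<open>catalan 1\<close> maps the relation for \<open>j\<close> to \<open>- (t - s)\<close> times the relation for \<open>j + 1\<close>.
\<close>

lemma catalan_x_catalan_exchange:
  assumes "t\<^sup>2 \<noteq> 1"
  shows "t \<odot> (catalan (Suc i) \<bowtie> x_catalan j) - catalan i \<bowtie> x_catalan (Suc j)
    = t \<odot> (x_catalan j \<bowtie> catalan (Suc i)) - t\<^sup>2 \<odot> (x_catalan (Suc j) \<bowtie> catalan i)"
proof (induction j)
  case 0
  show ?case using catalan_x_catalan_exchange_0[OF assms, of i] by (simp only: x_catalan_0 One_nat_def)
next
  case (Suc j)
  define c where "c = t - s"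
  have "commutator (catalan 1) (t \<odot> (catalan (Suc i) \<bowtie> x_catalan j) - catalan i \<bowtie> x_catalan (Suc j)) w
    = commutator (catalan 1) (t \<odot> (x_catalan j \<bowtie> catalan (Suc i)) - t\<^sup>2 \<odot> (x_catalan (Suc j) \<bowtie> catalan i)) w" for w
    unfolding Suc ..
  then have "c * (t \<odot> (catalan (Suc i) \<bowtie> x_catalan (Suc j)) - catalan i \<bowtie> x_catalan (Suc (Suc j))) w
    = c * (t \<odot> (x_catalan (Suc j) \<bowtie> catalan (Suc i)) - t\<^sup>2 \<odot> (x_catalan (Suc (Suc j)) \<bowtie> catalan i)) w" for w
    unfolding commutator_linear commutator_qshuffle catalan_1_commutes
      commutator_catalan_1_x_catalan[folded c_def]
    by (simp add: qshuffle_bilinear smul_simps algebra_simps)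
  moreover have "c \<noteq> 0"
    using assms by (simp add: c_def field_simps power2_eq_square)
  ultimately show ?case by (simp only: fun_eq_iff mult_left_cancel) simp
qed

text \<open>
Stripping the initial \<open>X\<close> gives the sum of the exchange relations for \<open>(i, j)\<close> and \<open>(j, i)\<close>.
\<close>

theorem x_catalan_relation:
  assumes "t\<^sup>2 \<noteq> 1"
  shows "t \<odot> (x_catalan (Suc i) \<bowtie> x_catalan j + x_catalan (Suc j) \<bowtie> x_catalan i)
    = x_catalan j \<bowtie> x_catalan (Suc i) + x_catalan i \<bowtie> x_catalan (Suc j)"
proof (rule series_eqI_prefix)
  fix a
  show "prefix_quot a (t \<odot> (x_catalan (Suc i) \<bowtie> x_catalan j + x_catalan (Suc j) \<bowtie> x_catalan i))
    = prefix_quot a (x_catalan j \<bowtie> x_catalan (Suc i) + x_catalan i \<bowtie> x_catalan (Suc j))"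
  proof (cases a)
    case X
    have "(t \<odot> (catalan (Suc i) \<bowtie> x_catalan j) - catalan i \<bowtie> x_catalan (Suc j)) w
      + (t \<odot> (catalan (Suc j) \<bowtie> x_catalan i) - catalan j \<bowtie> x_catalan (Suc i)) w
      = (t \<odot> (x_catalan j \<bowtie> catalan (Suc i)) - t\<^sup>2 \<odot> (x_catalan (Suc j) \<bowtie> catalan i)) w
      + (t \<odot> (x_catalan i \<bowtie> catalan (Suc j)) - t\<^sup>2 \<odot> (x_catalan (Suc i) \<bowtie> catalan j)) w" for w
      by (simp only: catalan_x_catalan_exchange[OF assms])
    with X show ?thesis
      by (simp add: prefix_quot_qshuffle qshuffle_bilinear smul_simps braid_def power2_eq_square)
        (simp add: fun_eq_iff algebra_simps)
  qed (simp add: prefix_quot_qshuffle qshuffle_bilinear smul_simps)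
qed simp

text \<open>
For \<open>i = j\<close> the preceding relation is twice this one. Deriving it from a single exchange relation
covers fields of characteristic two as well.
\<close>

theorem x_catalan_relation_diagonal:
  assumes "t\<^sup>2 \<noteq> 1"
  shows "t \<odot> (x_catalan (Suc i) \<bowtie> x_catalan i) = x_catalan i \<bowtie> x_catalan (Suc i)"
proof (rule series_eqI_prefix)
  fix a
  show "prefix_quot a (t \<odot> (x_catalan (Suc i) \<bowtie> x_catalan i)) = prefix_quot a (x_catalan i \<bowtie> x_catalan (Suc i))"
  proof (cases a)
    case X
    with catalan_x_catalan_exchange[OF assms, of i i] show ?thesis
      by (simp add: prefix_quot_qshuffle qshuffle_bilinear smul_simps braid_def power2_eq_square)
        (simp add: fun_eq_iff algebra_simps)
  qed (simp add: prefix_quot_qshuffle qshuffle_bilinear smul_simps)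
qed simp

lemma catalan_y_simps [simp]:
  "catalan_y n [] = 0"
  "suffix_quot a (catalan_y n) = (if a = Y then catalan n else 0)"
  "twist X (catalan_y n) = s \<odot> catalan_y n"
proof -
  show "twist X (catalan_y n) = s \<odot> catalan_y n"
  proof (rule series_eqI_suffix)
    show "suffix_quot a (twist X (catalan_y n)) = suffix_quot a (s \<odot> catalan_y n)" for a
      by (simp add: twist_suffix_quot catalan_y_def braid_def smul_simps)
  qed (simp add: catalan_y_def append_letter_def)
qed (simp_all add: catalan_y_def append_letter_def)

text \<open>
The mirror image of \<open>q_commutator_y_x_catalan\<close>, obtained from the exchange rule for \<open>\<xi>\<close> by stripping the
last letter. The two descriptions of \<open>catalan (Suc n)\<close> together make it invariant under reflection.
\<close>

lemma q_commutator_x_catalan_y: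
  "t \<odot> (\<xi> \<bowtie> catalan_y n) - catalan_y n \<bowtie> \<xi> = catalan (Suc n)"
proof (rule series_eqI_suffix)
  have "\<xi> \<bowtie> catalan n = s\<^sup>2 \<odot> (catalan n \<bowtie> \<xi>) + (s * (t - s)) \<odot> paths (Suc (2 * n)) 0 (Suc 0)"
    by (simp add: catalan_def x_qshuffle_paths numeral_2_eq_2 smul_simps)
  moreover have "suffix_quot X (catalan (Suc n)) = 0"
    "suffix_quot Y (catalan (Suc n)) = (t - s) \<odot> paths (Suc (2 * n)) 0 (Suc 0)"
    by (simp_all add: catalan_def)
  ultimately show "suffix_quot a (t \<odot> (\<xi> \<bowtie> catalan_y n) - catalan_y n \<bowtie> \<xi>) = suffix_quot a (catalan (Suc n))" for a
    by (cases a) (simp_all add: suffix_quot_qshuffle qshuffle_bilinear smul_simps braid_def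
      power2_eq_square, simp_all add: fun_eq_iff field_simps)
qed simp

lemma reflect_catalan: "reflect (catalan n) = catalan n"
proof (induction n)
  case 0
  show ?case by (simp add: reflect_def word_series_def fun_eq_iff)
next
  case (Suc n)
  have "catalan (Suc n) = t \<odot> (x_catalan n \<bowtie> \<eta>) - \<eta> \<bowtie> x_catalan n"
    using q_commutator_y_x_catalan[of n] by (simp add: algebra_simps)
  then have "reflect (catalan (Suc n)) = t \<odot> (\<xi> \<bowtie> catalan_y n) - catalan_y n \<bowtie> \<xi>"
    by (simp add: reflect_qshuffle reflect_prepend x_catalan_def catalan_y_def reflect_word_series Suc)
  then show ?case
    by (simp only: q_commutator_x_catalan_y)
qed

theorem catalan_y_relation:
  assumes "t\<^sup>2 \<noteq> 1"
  shows "t \<odot> (catalan_y j \<bowtie> catalan_y (Suc i) + catalan_y i \<bowtie> catalan_y (Suc j))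
    = catalan_y (Suc i) \<bowtie> catalan_y j + catalan_y (Suc j) \<bowtie> catalan_y i"
  using x_catalan_relation[OF assms, of i j, THEN arg_cong[of _ _ reflect]]
  by (simp add: reflect_qshuffle reflect_prepend x_catalan_def catalan_y_def reflect_catalan)

theorem catalan_y_relation_diagonal:
  assumes "t\<^sup>2 \<noteq> 1"
  shows "t \<odot> (catalan_y i \<bowtie> catalan_y (Suc i)) = catalan_y (Suc i) \<bowtie> catalan_y i"
  using x_catalan_relation_diagonal[OF assms, of i, THEN arg_cong[of _ _ reflect]]
  by (simp add: reflect_qshuffle reflect_prepend x_catalan_def catalan_y_def reflect_catalan)

section \<open>Catalan coefficients by insertion of a letter\<close>

lemma path_weight_nonzero:
  assumes "path_weight h k w \<noteq> 0"
  shows "int k = int h + total_weight w" "i \<le> length w \<Longrightarrow> int h + total_weight (take i w) \<ge> 0"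
proof -
  have "int k = int h + total_weight w \<and> (\<forall>i\<le>length w. int h + total_weight (take i w) \<ge> 0)"
    using assms
  proof (induction w arbitrary: h)
    case Nil
    then show ?case by (auto split: if_splits)
  next
    case (Cons a w)
    define h' where "h' = (if a = X then Suc h else h - 1)"
    have "a = Y \<Longrightarrow> h \<noteq> 0"
      using Cons.prems by (intro notI) simp
    then have h': "int h' = int h + weight a"
      by (cases a) (auto simp: h'_def of_nat_diff)
    have IH: "int k = int h' + total_weight w" "\<forall>i\<le>length w. 0 \<le> int h' + total_weight (take i w)"
      using Cons.IH[of h'] Cons.prems by (cases a; simp add: h'_def)+
    have "0 \<le> int h + total_weight (take i (a # w))" if "i \<le> Suc (length w)" for i
      using that IH(2) h' by (cases i) (auto simp: add.assoc)
    then show ?case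
      using IH(1) h' by simp
  qed
  then show "int k = int h + total_weight w" "i \<le> length w \<Longrightarrow> int h + total_weight (take i w) \<ge> 0"
    by auto
qed

lemma catalan_support:
  assumes "catalan n w \<noteq> 0"
  shows "w \<in> Cat n"
  using assms path_weight_nonzero[of 0 0 w]
  by (auto simp: catalan_def paths_def Cat_def catalan_word_def split: if_splits)

lemma braid_X_eq: "braid X a = t powi weight a" "braid a X = t powi weight a"
  by (cases a; simp add: braid_def power_int_minus)+

text \<open>
Shuffling with a single letter inserts it; read backwards, the coefficient at \<open>w\<close> is a sum over the
occurrences of this letter in \<open>w\<close>.
\<close>

lemma x_qshuffle_apply:
  "(\<xi> \<bowtie> f) w = (\<Sum>i<length w. if w ! i = X
     then t powi total_weight (take i w) * f (take i w @ drop (Suc i) w) else 0)"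
proof (induction w arbitrary: f)
  case Nil
  show ?case by (simp add: word_series_def)
next
  case (Cons a w)
  have "(\<xi> \<bowtie> f) (a # w) = (if a = X then f w else 0) + t powi weight a * (\<xi> \<bowtie> prefix_quot a f) w"
    by (simp add: qshuffle_bilinear braid_X_eq)
  then show ?case
    unfolding Cons
    by (simp del: sum.lessThan_Suc qshuffle.simps
        add: sum.lessThan_Suc_shift power_int_add sum_distrib_left prefix_quot_def if_distrib mult.assoc
        cong: if_cong)
qed

lemma qshuffle_x_apply:
  "(f \<bowtie> \<xi>) w = (\<Sum>i<length w. if w ! i = X
     then t powi total_weight (drop (Suc i) w) * f (take i w @ drop (Suc i) w) else 0)"
proof (induction w arbitrary: f)
  case Nil
  show ?case by (simp add: word_series_def)
next
  case (Cons a w)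
  have "(\<Prod>c\<leftarrow>w. braid c X) = t powi total_weight w"
    by (induction w) (simp_all add: braid_X_eq power_int_add)
  then have "(f \<bowtie> \<xi>) (a # w) = (prefix_quot a f \<bowtie> \<xi>) w + (if a = X then t powi total_weight w * f w else 0)"
    by (simp add: twist_def qshuffle_bilinear)
  then show ?case
    unfolding Cons
    by (simp del: sum.lessThan_Suc qshuffle.simps
        add: sum.lessThan_Suc_shift prefix_quot_def if_distrib cong: if_cong)
qed

text \<open>
The defining recursion of the Catalan coefficients, with \<open>t\<^sup>k - t\<^sup>-\<^sup>k\<close> in place of the bracket. By
\<open>q_commutator_x_catalan_y\<close>, stripping the last letter of \<open>catalan (Suc n)\<close> leaves a combination of
\<open>\<xi> \<bowtie> catalan n\<close> and \<open>catalan n \<bowtie> \<xi>\<close>. In every contributing term the letters before and after the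
inserted \<open>X\<close> have opposite weights, so that both products depend on the height of insertion only.
\<close>

lemma catalan_Suc_apply:
  "catalan (Suc n) (u @ [Y]) = (\<Sum>i<length u. if u ! i = X
     then (t powi (1 + total_weight (take i u)) - t powi (- (1 + total_weight (take i u))))
       * catalan n (take i u @ drop (Suc i) u) else 0)"
proof -
  have "suffix_quot Y (catalan (Suc n)) = t \<odot> (\<xi> \<bowtie> catalan n) - s \<odot> (catalan n \<bowtie> \<xi>)"
    unfolding q_commutator_x_catalan_y[symmetric]
    by (simp add: suffix_quot_qshuffle qshuffle_bilinear braid_def smul_simps)
  then have "catalan (Suc n) (u @ [Y]) = t * (\<xi> \<bowtie> catalan n) u - s * (catalan n \<bowtie> \<xi>) u"
    by (simp add: suffix_quot_def fun_eq_iff)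
  also have "\<dots> = (\<Sum>i<length u. if u ! i = X
     then (t * t powi total_weight (take i u) - s * t powi total_weight (drop (Suc i) u))
       * catalan n (take i u @ drop (Suc i) u) else 0)"
    unfolding x_qshuffle_apply qshuffle_x_apply sum_distrib_left sum_subtractf[symmetric]
    by (intro sum.cong) (simp_all add: algebra_simps)
  also have "\<dots> = (\<Sum>i<length u. if u ! i = X
     then (t powi (1 + total_weight (take i u)) - t powi (- (1 + total_weight (take i u))))
       * catalan n (take i u @ drop (Suc i) u) else 0)"
  proof (intro sum.cong refl if_cong)
    fix i
    show "(t * t powi total_weight (take i u) - s * t powi total_weight (drop (Suc i) u))
       * catalan n (take i u @ drop (Suc i) u)
      = (t powi (1 + total_weight (take i u)) - t powi (- (1 + total_weight (take i u))))
       * catalan n (take i u @ drop (Suc i) u)"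
    proof (cases "catalan n (take i u @ drop (Suc i) u) = 0")
      case False
      then have "total_weight (drop (Suc i) u) = - total_weight (take i u)"
        using catalan_support[OF False] by (simp add: Cat_def catalan_word_def)
      then show ?thesis by (simp add: power_int_add power_int_minus power_int_diff field_simps)
    qed simp
  qed
  finally show ?thesis .
qed

end

section \<open>The free algebra over the rational function field\<close>

lemma lookup_sum: "Poly_Mapping.lookup (\<Sum>i\<in>I. f i) w = (\<Sum>i\<in>I. Poly_Mapping.lookup (f i) w)"
  by (induction I rule: infinite_finite_induct) (simp_all add: Poly_Mapping.lookup_add)

lemma sum_monomials:
  fixes p :: free_alg
  shows "p = (\<Sum>u\<in>Poly_Mapping.keys p. Poly_Mapping.single u (Poly_Mapping.lookup p u))"
  by (rule poly_mapping_eqI) (auto simp: lookup_sum lookup_single when_def in_keys_iff)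

lemma lookup_letter_times:
  fixes p :: free_alg
  shows "Poly_Mapping.lookup (of_word [a] * p) = prepend_letter a (Poly_Mapping.lookup p)"
proof
  fix w
  have "of_word [a] * p = (\<Sum>u\<in>Poly_Mapping.keys p. Poly_Mapping.single (a # u) (Poly_Mapping.lookup p u))"
    by (subst sum_monomials[of p])
      (simp add: sum_distrib_left Poly_Mapping.mult_single plus_list_def)
  then show "Poly_Mapping.lookup (of_word [a] * p) w = prepend_letter a (Poly_Mapping.lookup p) w"
    by (cases w) (auto simp: lookup_sum lookup_single when_def in_keys_iff)
qed

lemma lookup_times_letter:
  fixes p :: free_alg
  shows "Poly_Mapping.lookup (p * of_word [a]) = append_letter a (Poly_Mapping.lookup p)"
proof
  fix w
  have "p * of_word [a] = (\<Sum>u\<in>Poly_Mapping.keys p. Poly_Mapping.single (u @ [a]) (Poly_Mapping.lookup p u))"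
    by (subst sum_monomials[of p])
      (simp add: sum_distrib_right Poly_Mapping.mult_single plus_list_def)
  then show "Poly_Mapping.lookup (p * of_word [a]) w = append_letter a (Poly_Mapping.lookup p) w"
    by (cases w rule: rev_cases) (auto simp: append_letter_def lookup_sum lookup_single when_def in_keys_iff)
qed

text \<open>
The sign \<open>(- 1)\<close> for each letter of the left word is absorbed into the braiding.
\<close>

interpretation super: quantum_shuffle "- \<q>\<^sup>2"
  by standard (simp add: qvar_nonzero)

lemma sum_series_apply: "(\<Sum>i\<in>I. f i) w = (\<Sum>i\<in>I. f i w)" for f :: "_ \<Rightarrow> 'a::comm_ring_1 series"
  by (induction I rule: infinite_finite_induct) simp_all

lemma super_braid: "super.braid c a = - (\<q> powi \<langle>c, a\<rangle>)"
  by (cases c; cases a) (simp_all add: super.braid_def power_int_minus)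

lemma lookup_of_word: "Poly_Mapping.lookup (of_word u) = (word_series u :: scalar series)"
  by (auto simp: word_series_def lookup_single when_def fun_eq_iff)

lemma lookup_shuffle_word:
  "Poly_Mapping.lookup (shuffle_word u v) = super.qshuffle (word_series u) (word_series v)"
proof (induction u v rule: shuffle_word.induct)
  case (3 a u b v)
  have braid: "(\<Prod>c\<leftarrow>u. super.braid c b) = (- 1) ^ length u * \<q> powi (\<Sum>c\<leftarrow>u. \<langle>c, b\<rangle>)" for u b
    by (induction u) (simp_all add: super_braid power_int_add qvar_nonzero)
  define k where "k = (\<Prod>c\<leftarrow>a # u. super.braid c b)"
  have tw: "super.twist b (word_series (a # u)) = k \<odot> word_series (a # u)"
    by (simp only: super.twist_simps k_def)
  have "Poly_Mapping.lookup (shuffle_word (a # u) (b # v))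
    = prepend_letter a (super.qshuffle (word_series u) (word_series (b # v)))
      + k \<odot> prepend_letter b (super.qshuffle (word_series (a # u)) (word_series v))"
    unfolding braid k_def shuffle_word.simps
    by (rule ext) (simp only: plus_fun_apply smul_apply Poly_Mapping.lookup_add lookup_scale lookup_letter_times 3)
  also have "\<dots> = super.qshuffle (word_series (a # u)) (word_series (b # v))"
  proof (rule series_eqI_prefix)
    fix c
    show "prefix_quot c (prepend_letter a (super.qshuffle (word_series u) (word_series (b # v)))
      + k \<odot> prepend_letter b (super.qshuffle (word_series (a # u)) (word_series v)))
      = prefix_quot c (super.qshuffle (word_series (a # u)) (word_series (b # v)))"
      using tw
      by (cases "c = a"; cases "c = b"; simp del: super.twist_simps(6)
          add: super.prefix_quot_qshuffle super.qshuffle_bilinear smul_simps)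
  qed (simp add: word_series_def)
  finally show ?case .
qed (simp_all add: lookup_of_word)

lemma lookup_shuffle:
  "Poly_Mapping.lookup (p \<star> r) = super.qshuffle (Poly_Mapping.lookup p) (Poly_Mapping.lookup r)"
proof -
  have delta: "c * (if P then 1 else 0) = (if P then c else 0)" for c :: scalar and P
    by simp
  have expand: "Poly_Mapping.lookup p = (\<Sum>u\<in>Poly_Mapping.keys p. Poly_Mapping.lookup p u \<odot> word_series u)"
    for p :: free_alg
    by (auto simp: fun_eq_iff sum_series_apply word_series_def in_keys_iff delta)
  have sum_left: "super.qshuffle (\<Sum>i\<in>I. f i) g = (\<Sum>i\<in>I. super.qshuffle (f i) g)" for I :: "word set" and f g
    using sum_comp_morphism[of "\<lambda>f. super.qshuffle f g" f I]
    by (simp only: super.qshuffle_bilinear o_def simp_thms)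
  have sum_right: "super.qshuffle g (\<Sum>i\<in>I. f i) = (\<Sum>i\<in>I. super.qshuffle g (f i))" for I :: "word set" and f g
    using sum_comp_morphism[of "super.qshuffle g" f I]
    by (simp only: super.qshuffle_bilinear o_def simp_thms)
  have right: "super.qshuffle f (Poly_Mapping.lookup r) w
    = (\<Sum>v\<in>Poly_Mapping.keys r. Poly_Mapping.lookup r v * super.qshuffle f (word_series v) w)" for f w
    by (subst expand) (simp add: sum_right super.qshuffle_bilinear sum_series_apply)
  have left: "super.qshuffle (Poly_Mapping.lookup p) f w
    = (\<Sum>u\<in>Poly_Mapping.keys p. Poly_Mapping.lookup p u * super.qshuffle (word_series u) f w)" for f w
    by (subst expand) (simp add: sum_left super.qshuffle_bilinear sum_series_apply)
  show ?thesis
    unfolding fun_eq_iff left[of "Poly_Mapping.lookup r"] unfolding right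
    by (simp add: shuffle_def lookup_sum lookup_scale lookup_shuffle_word sum_distrib_left mult.assoc)
qed

text \<open>
The argument \<open>2 (1 + h)\<close> of the bracket is even, and the sign in front of it equals
\<open>- (- 1) powi (1 + h)\<close>, which turns the powers of \<open>q\<^sup>2\<close> into powers of \<open>- q\<^sup>2\<close>. The hypothesis says that \<open>i\<close> and \<open>h\<close> have the same parity, as the length and the
height of a path do.
\<close>

lemma signed_qbracket:
  assumes "(- 1 :: scalar) ^ i = (- 1) powi h"
  shows "(- 1) ^ i * {2 + 2 * h}\<^sub>q
    = inverse (\<q> + inverse \<q>) * ((- \<q>\<^sup>2) powi (1 + h) - (- \<q>\<^sup>2) powi (- (1 + h)))"
proof -
  have *: "(- \<q>\<^sup>2) powi m = (- 1) powi m * \<q> powi (2 * m)" for m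
  proof -
    have "- \<q>\<^sup>2 = (- 1) * \<q>\<^sup>2" by simp
    then show ?thesis by (simp only: power_int_mult_distrib power_int_mult) (simp add: power_int_def)
  qed
  have sign: "(- 1 :: scalar) powi h = 1 \<or> (- 1 :: scalar) powi h = - 1"
    using assms by (metis power_minus1_even power_minus1_odd evenE oddE add.commute plus_1_eq_Suc)
  have shift: "(- 1 :: scalar) powi (1 + h) = - ((- 1) powi h)"
    by (simp only: power_int_add[of "- 1 :: scalar"] simp_thms neg_equal_0_iff_equal one_neq_zero
        power_int_1_right mult_minus_left mult_1_left)
  have "(- 1 :: scalar) powi (- (1 + h)) = inverse (- ((- 1) powi h))"
    by (simp only: power_int_minus shift)
  also have "\<dots> = - ((- 1) powi h)"
    using sign by (elim disjE) (simp_all only: minus_minus inverse_1 inverse_minus_eq)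
  finally have neg: "(- 1 :: scalar) powi (- (1 + h)) = - ((- 1) powi h)" .
  have even: "(- 1 :: scalar) powi (2 + 2 * h) = 1"
  proof -
    have "(- 1 :: scalar) powi (2 * (1 + h)) = 1"
      by (simp only: power_int_mult) simp
    then show ?thesis by (simp only: distrib_left mult_1_right)
  qed
  have "2 * (1 + h) = 2 + 2 * h" "2 * (- (1 + h)) = - (2 + 2 * h)"
    by simp_all
  then show ?thesis
    unfolding qbracket_def * assms shift neg even
    by (simp only: divide_inverse) (simp add: algebra_simps)
qed

lemma minus_one_power_length: "(- 1 :: scalar) ^ length w = (- 1) powi total_weight w"
proof (induction w)
  case (Cons a w)
  then show ?case by (cases a) (simp_all add: power_int_add power_int_diff)
qed simp

text \<open>
The double sum over a Catalan word \<open>v\<close> and a position of insertion is a single sum over the occurrences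
of \<open>X\<close> in \<open>w\<close> without its last letter, since \<open>v\<close> is recovered by deleting the inserted letter. Each step of the
recursion contributes one factor \<open>1 / (q + 1 / q)\<close> from the bracket.
\<close>

lemma cat_coeff_eq:
  "cat_coeff n w = inverse (\<q> + inverse \<q>) ^ n * super.catalan n w"
proof (induction n arbitrary: w)
  case 0
  show ?case by (simp add: word_series_def)
next
  case (Suc n)
  let ?r = "inverse (\<q> + inverse \<q>)"
  show ?case
  proof (cases "\<exists>u. w = u @ [Y]")
    case False
    then have "super.catalan (Suc n) w = 0"
      by (cases w rule: rev_cases; cases "last w") (auto simp: super.catalan_def super.paths_def)
    moreover have "w \<noteq> take i v @ [X] @ drop i v @ [Y]" for i v
      using False by (metis append_assoc)
    ultimately show ?thesis by (simp del: append.simps)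
  next
    case True
    then obtain u where w: "w = u @ [Y]" by blast
    let ?\<phi> = "\<lambda>i v. (- 1) ^ i * {2 + 2 * total_weight (take i v)}\<^sub>q"
    let ?d = "\<lambda>i. take i u @ drop (Suc i) u"
    \<comment> \<open>\<open>?d i\<close> undoes the insertion at position \<open>i\<close>.\<close>
    have delete: "u = take i u @ X # drop (Suc i) u" if "i < length u" "u ! i = X" for i
      using that by (metis id_take_nth_drop)
    have "cat_coeff (Suc n) w = (\<Sum>v\<in>Cat n. \<Sum>i | i \<le> length v \<and> u = take i v @ [X] @ drop i v.
        cat_coeff n v * ?\<phi> i v)"
      unfolding w by (simp add: sum_distrib_left)
    also have "\<dots> = (\<Sum>(v, i)\<in>Sigma (Cat n) (\<lambda>v. {i. i \<le> length v \<and> u = take i v @ [X] @ drop i v}).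
        cat_coeff n v * ?\<phi> i v)"
      by (rule sum.Sigma) (auto simp: finite_Cat)
    also have "\<dots> = (\<Sum>i | i < length u \<and> u ! i = X \<and> ?d i \<in> Cat n. cat_coeff n (?d i) * ?\<phi> i u)"
      by (rule sum.reindex_bij_witness[of _ "\<lambda>i. (?d i, i)" snd])
        (auto simp: nth_append min_def intro: delete)
    also have "\<dots> = (\<Sum>i | i < length u \<and> u ! i = X \<and> ?d i \<in> Cat n.
        ?r ^ Suc n * (((- \<q>\<^sup>2) powi (1 + total_weight (take i u)) - (- \<q>\<^sup>2) powi (- (1 + total_weight (take i u))))
          * super.catalan n (?d i)))"
    proof (intro sum.cong refl)
      fix i assume "i \<in> {i. i < length u \<and> u ! i = X \<and> ?d i \<in> Cat n}"
      then have "(- 1 :: scalar) ^ i = (- 1) powi total_weight (take i u)"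
        using minus_one_power_length[of "take i u"] by simp
      from signed_qbracket[OF this]
      show "cat_coeff n (?d i) * ?\<phi> i u = ?r ^ Suc n *
        (((- \<q>\<^sup>2) powi (1 + total_weight (take i u)) - (- \<q>\<^sup>2) powi (- (1 + total_weight (take i u))))
          * super.catalan n (?d i))"
        unfolding Suc by (simp add: ac_simps)
    qed
    also have "\<dots> = (\<Sum>i<length u. ?r ^ Suc n * (if u ! i = X
      then ((- \<q>\<^sup>2) powi (1 + total_weight (take i u)) - (- \<q>\<^sup>2) powi (- (1 + total_weight (take i u))))
          * super.catalan n (?d i) else 0))"
      by (rule sum.mono_neutral_cong_left) (auto dest: super.catalan_support)
    also have "\<dots> = ?r ^ Suc n * super.catalan (Suc n) w"
      unfolding w super.catalan_Suc_apply sum_distrib_left ..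
    finally show ?thesis .
  qed
qed

lemma lookup_catalan_elem:
  "Poly_Mapping.lookup (C\<^sup>s n) = inverse (\<q> + inverse \<q>) ^ n \<odot> super.catalan n"
proof
  fix w
  show "Poly_Mapping.lookup (C\<^sup>s n) w = (inverse (\<q> + inverse \<q>) ^ n \<odot> super.catalan n) w"
    using super.catalan_support[of n w]
    by (auto simp: catalan_elem_def lookup_sum lookup_single when_def cat_coeff_eq finite_Cat)
qed

lemma lookup_x_catalan:
  "Poly_Mapping.lookup (\<x> * C\<^sup>s n) = inverse (\<q> + inverse \<q>) ^ n \<odot> super.x_catalan n"
  unfolding lookup_letter_times lookup_catalan_elem super.x_catalan_def
  by (rule series_eqI_prefix) (simp_all add: smul_simps)

lemma lookup_catalan_y:
  "Poly_Mapping.lookup (C\<^sup>s n * \<y>) = inverse (\<q> + inverse \<q>) ^ n \<odot> super.catalan_y n"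
  unfolding lookup_times_letter lookup_catalan_elem super.catalan_y_def
  by (rule series_eqI_suffix) (simp_all add: smul_simps append_letter_def)

theorem corollary59:
  shows "(\<forall>i::nat.
      \<q> \<cdot> ((\<x> * C\<^sup>s (i + 1)) \<star> (\<x> * C\<^sup>s i)) =
        - (inverse \<q> \<cdot> ((\<x> * C\<^sup>s i) \<star> (\<x> * C\<^sup>s (i + 1)))) \<and>
      \<q> \<cdot> ((C\<^sup>s i * \<y>) \<star> (C\<^sup>s (i + 1) * \<y>)) =
        - (inverse \<q> \<cdot> ((C\<^sup>s (i + 1) * \<y>) \<star> (C\<^sup>s i * \<y>)))) \<and>
    (\<forall>i j::nat. i \<noteq> j \<longrightarrow>
      \<q> \<cdot> ((\<x> * C\<^sup>s (i + 1)) \<star> (\<x> * C\<^sup>s j)) +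
        inverse \<q> \<cdot> ((\<x> * C\<^sup>s j) \<star> (\<x> * C\<^sup>s (i + 1))) =
      - (inverse \<q> \<cdot> ((\<x> * C\<^sup>s i) \<star> (\<x> * C\<^sup>s (j + 1)))) -
        \<q> \<cdot> ((\<x> * C\<^sup>s (j + 1)) \<star> (\<x> * C\<^sup>s i)) \<and>
      \<q> \<cdot> ((C\<^sup>s j * \<y>) \<star> (C\<^sup>s (i + 1) * \<y>)) +
        inverse \<q> \<cdot> ((C\<^sup>s (i + 1) * \<y>) \<star> (C\<^sup>s j * \<y>)) =
      - (inverse \<q> \<cdot> ((C\<^sup>s (j + 1) * \<y>) \<star> (C\<^sup>s i * \<y>))) -
        \<q> \<cdot> ((C\<^sup>s i * \<y>) \<star> (C\<^sup>s (j + 1) * \<y>)))"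
proof -
  define r where "r = inverse (\<q> + inverse \<q>)"
  \<comment> \<open>\<open>\<q>\<close> is not a root of unity, so the factor \<open>t - 1 / t\<close> may be cancelled.\<close>
  have q4: "(- \<q>\<^sup>2)\<^sup>2 \<noteq> 1"
    by (simp add: qvar_def One_fract_def eq_fract eval_nat_numeral one_pCons)
  note lookups = lookup_scale Poly_Mapping.lookup_add Poly_Mapping.lookup_minus
    lookup_shuffle lookup_x_catalan[folded r_def] lookup_catalan_y[folded r_def] super.qshuffle_bilinear
  \<comment> \<open>Both sides carry the same power of the normalising constant \<open>r\<close>, and \<open>- \<q>\<^sup>2\<close> is the ratio of the
    coefficients \<open>\<q>\<close> and \<open>- inverse \<q>\<close>.\<close>
  have diagonal: "\<q> * (r ^ Suc i * (r ^ i * a)) = - (inverse \<q> * (r ^ Suc i * (r ^ i * b)))"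
    if "- \<q>\<^sup>2 * a = b" for i a b
    using that by (auto simp: qvar_nonzero field_simps power2_eq_square)
  have off_diagonal: "\<q> * (r ^ Suc i * (r ^ j * a)) + inverse \<q> * (r ^ Suc i * (r ^ j * c))
    = - (inverse \<q> * (r ^ i * (r ^ Suc j * d))) - \<q> * (r ^ i * (r ^ Suc j * b))"
    if "- \<q>\<^sup>2 * (a + b) = c + d" for i j a b c d
  proof -
    have "c = - \<q>\<^sup>2 * (a + b) - d"
      using that by simp
    then show ?thesis
      by (simp only:) (simp add: qvar_nonzero field_simps power2_eq_square)
  qed
  have x_diagonal: "\<q> \<cdot> ((\<x> * C\<^sup>s (i + 1)) \<star> (\<x> * C\<^sup>s i)) =
      - (inverse \<q> \<cdot> ((\<x> * C\<^sup>s i) \<star> (\<x> * C\<^sup>s (i + 1))))" for i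
  proof (rule poly_mapping_eqI)
    fix w
    show "Poly_Mapping.lookup (\<q> \<cdot> ((\<x> * C\<^sup>s (i + 1)) \<star> (\<x> * C\<^sup>s i))) w =
        Poly_Mapping.lookup (- (inverse \<q> \<cdot> ((\<x> * C\<^sup>s i) \<star> (\<x> * C\<^sup>s (i + 1))))) w"
      using diagonal[OF super.x_catalan_relation_diagonal[OF q4, THEN fun_cong, of i w,
        unfolded smul_apply plus_fun_apply]]
      by (simp add: lookups mult.left_commute)
  qed
  have y_diagonal: "\<q> \<cdot> ((C\<^sup>s i * \<y>) \<star> (C\<^sup>s (i + 1) * \<y>)) =
      - (inverse \<q> \<cdot> ((C\<^sup>s (i + 1) * \<y>) \<star> (C\<^sup>s i * \<y>)))" for i
  proof (rule poly_mapping_eqI)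
    fix w
    show "Poly_Mapping.lookup (\<q> \<cdot> ((C\<^sup>s i * \<y>) \<star> (C\<^sup>s (i + 1) * \<y>))) w =
        Poly_Mapping.lookup (- (inverse \<q> \<cdot> ((C\<^sup>s (i + 1) * \<y>) \<star> (C\<^sup>s i * \<y>)))) w"
      using diagonal[OF super.catalan_y_relation_diagonal[OF q4, THEN fun_cong, of i w,
        unfolded smul_apply plus_fun_apply]]
      by (simp add: lookups mult.left_commute)
  qed
  have x_off_diagonal: "\<q> \<cdot> ((\<x> * C\<^sup>s (i + 1)) \<star> (\<x> * C\<^sup>s j)) +
        inverse \<q> \<cdot> ((\<x> * C\<^sup>s j) \<star> (\<x> * C\<^sup>s (i + 1))) =
      - (inverse \<q> \<cdot> ((\<x> * C\<^sup>s i) \<star> (\<x> * C\<^sup>s (j + 1)))) -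
        \<q> \<cdot> ((\<x> * C\<^sup>s (j + 1)) \<star> (\<x> * C\<^sup>s i))" for i j
  proof (rule poly_mapping_eqI)
    fix w
    show "Poly_Mapping.lookup (\<q> \<cdot> ((\<x> * C\<^sup>s (i + 1)) \<star> (\<x> * C\<^sup>s j)) +
        inverse \<q> \<cdot> ((\<x> * C\<^sup>s j) \<star> (\<x> * C\<^sup>s (i + 1)))) w =
        Poly_Mapping.lookup (- (inverse \<q> \<cdot> ((\<x> * C\<^sup>s i) \<star> (\<x> * C\<^sup>s (j + 1)))) -
        \<q> \<cdot> ((\<x> * C\<^sup>s (j + 1)) \<star> (\<x> * C\<^sup>s i))) w"
      using off_diagonal[OF super.x_catalan_relation[OF q4, THEN fun_cong, of i j w,
        unfolded smul_apply plus_fun_apply]]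
      by (simp add: lookups mult.left_commute)
  qed
  have y_off_diagonal: "\<q> \<cdot> ((C\<^sup>s j * \<y>) \<star> (C\<^sup>s (i + 1) * \<y>)) +
        inverse \<q> \<cdot> ((C\<^sup>s (i + 1) * \<y>) \<star> (C\<^sup>s j * \<y>)) =
      - (inverse \<q> \<cdot> ((C\<^sup>s (j + 1) * \<y>) \<star> (C\<^sup>s i * \<y>))) -
        \<q> \<cdot> ((C\<^sup>s i * \<y>) \<star> (C\<^sup>s (j + 1) * \<y>))" for i j
  proof (rule poly_mapping_eqI)
    fix w
    show "Poly_Mapping.lookup (\<q> \<cdot> ((C\<^sup>s j * \<y>) \<star> (C\<^sup>s (i + 1) * \<y>)) +
        inverse \<q> \<cdot> ((C\<^sup>s (i + 1) * \<y>) \<star> (C\<^sup>s j * \<y>))) w =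
        Poly_Mapping.lookup (- (inverse \<q> \<cdot> ((C\<^sup>s (j + 1) * \<y>) \<star> (C\<^sup>s i * \<y>))) -
        \<q> \<cdot> ((C\<^sup>s i * \<y>) \<star> (C\<^sup>s (j + 1) * \<y>))) w"
      using off_diagonal[OF super.catalan_y_relation[OF q4, THEN fun_cong, of j i w,
        unfolded smul_apply plus_fun_apply]]
      by (simp add: lookups mult.left_commute)
  qed
  show ?thesis
    using x_diagonal y_diagonal x_off_diagonal y_off_diagonal by blast
qed

end
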